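(* Let $U\subset\mathbb R$ (respectively $U\subset\mathbb C$) be an open set and let $\mathcal O(U)$ be the ring of $\mathbb R$-derivable (that is, differentiable) functions defined on $U$ with values in $\mathbb R$ (respectively of holomorphic functions defined on $U$ with values in $\mathbb C$). Consider $$\widetilde D:\mathcal F(\mathbb N^*,\mathcal O(U))\to\mathcal F(\mathbb N^*,\mathcal O(U)),\quad \widetilde D(\alpha)(n)(z):=\alpha(n)'(z)-\alpha(n)(z)\log n,\quad \text{for all } n\in\mathbb N^*,\ z\in U.$$ Then $\widetilde D$ is an $\mathbb R$-derivation (respectively a $\mathbb C$-derivation) on $\mathcal F(\mathbb N^*,\mathcal O(U))$. In the language of sheaf theory, $\mathcal F(\mathbb N^*,\mathcal O)$ is a sheaf of $\mathcal O$-algebras and $\widetilde D:\mathcal F(\mathbb N^*,\mathcal O)\to\mathcal F(\mathbb N^*,\mathcal O)$ is an $\mathbb R$-derivation (respectively a $\mathbb C$-derivation).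
   Context: $\mathbb N^*$ is the multiplicative monoid of positive integers. For a commutative ring $R$ with unity, $\mathcal F(\mathbb N^*,R)$ is the set of all functions $\alpha:\mathbb N^*\to R$, a commutative $R$-algebra with unity under pointwise addition and the Dirichlet convolution $(\alpha\cdot\beta)(n)=\sum_{ab=n}\alpha(a)\beta(b)$ ($R$ acting by pointwise multiplication). For a commutative ring $A$, an $A$-derivation on a commutative $A$-algebra $S$ is an $A$-linear map $D:S\to S$ with $D(fg)=fD(g)+gD(f)$ for all $f,g\in S$. $\mathcal O$ denotes the sheaf $U\mapsto\mathcal O(U)$ on $\mathbb R$ (respectively $\mathbb C$), and $\mathcal F(\mathbb N^*,\mathcal O)$ denotes the assignment $U\mapsto\mathcal F(\mathbb N^*,\mathcal O(U))$, with restriction maps induced by those of $\mathcal O$ (applied value by value); $\widetilde D$ on it is given over each open $U$ by the formula in the claim.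
   Formalization: For real differentiable functions the derivation takes values in arithmetical functions over all functions U→R, since a derivative need not be differentiable (x|x|); the self-map claim is proved for infinitely differentiable real functions and for holomorphic functions. *)

theory Defs
  imports "HOL-Complex_Analysis.Complex_Analysis" "HOL-Algebra.Algebraic_Closure_Type"
begin

section \<open>Algebras of arithmetical functions and derivations\<close>

abbreviation pos_nats :: "nat set" where
  "pos_nats \<equiv> {0<..}"

text \<open>
  \<open>F(N*, R)\<close>: functions on the positive integers with values in \<open>R\<close>, represented as functions
  that are \<open>undefined\<close> at \<open>0\<close>.
\<close>
definition arith_fun_algebra :: "('r, 'm) ring_scheme \<Rightarrow> ('r, nat \<Rightarrow> 'r) module" where
  "arith_fun_algebra R =
    \<lparr>carrier = pos_nats \<rightarrow>\<^sub>E carrier R,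
     mult = (\<lambda>\<alpha> \<beta>. \<lambda>n\<in>pos_nats. \<Oplus>\<^bsub>R\<^esub>p\<in>{(a, b). a * b = n}. \<alpha> (fst p) \<otimes>\<^bsub>R\<^esub> \<beta> (snd p)),
     one = (\<lambda>n\<in>pos_nats. if n = 1 then \<one>\<^bsub>R\<^esub> else \<zero>\<^bsub>R\<^esub>),
     zero = (\<lambda>n\<in>pos_nats. \<zero>\<^bsub>R\<^esub>),
     add = (\<lambda>\<alpha> \<beta>. \<lambda>n\<in>pos_nats. \<alpha> n \<oplus>\<^bsub>R\<^esub> \<beta> n),
     smult = (\<lambda>r \<alpha>. \<lambda>n\<in>pos_nats. r \<otimes>\<^bsub>R\<^esub> \<alpha> n)\<rparr>"

definition restrict_scalars :: "('c \<Rightarrow> 'r) \<Rightarrow> ('r, 's) module \<Rightarrow> ('c, 's) module" where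
  "restrict_scalars \<phi> S =
    \<lparr>carrier = carrier S, mult = mult S, one = one S, zero = zero S, add = add S,
     smult = (\<lambda>c x. \<phi> c \<odot>\<^bsub>S\<^esub> x)\<rparr>"

locale derivation = Module.algebra A S
  for A :: "('a, 'm) ring_scheme" and S :: "('a, 's, 'n) module_scheme" +
  fixes D :: "'s \<Rightarrow> 's"
  assumes closed: "f \<in> carrier S \<Longrightarrow> D f \<in> carrier S"
    and additive: "\<lbrakk>f \<in> carrier S; g \<in> carrier S\<rbrakk> \<Longrightarrow> D (f \<oplus>\<^bsub>S\<^esub> g) = D f \<oplus>\<^bsub>S\<^esub> D g"
    and homogeneous: "\<lbrakk>a \<in> carrier A; f \<in> carrier S\<rbrakk> \<Longrightarrow> D (a \<odot>\<^bsub>S\<^esub> f) = a \<odot>\<^bsub>S\<^esub> D f"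
    and leibniz: "\<lbrakk>f \<in> carrier S; g \<in> carrier S\<rbrakk> \<Longrightarrow>
      D (f \<otimes>\<^bsub>S\<^esub> g) = f \<otimes>\<^bsub>S\<^esub> D g \<oplus>\<^bsub>S\<^esub> g \<otimes>\<^bsub>S\<^esub> D f"

text \<open>
  A derivation of an \<open>A\<close>-algebra \<open>S\<close> with values in an \<open>A\<close>-algebra \<open>T\<close> that contains \<open>S\<close>
  as a subalgebra, \<open>T\<close> being regarded as an \<open>S\<close>-module.
\<close>
locale derivation_into =
  S: Module.algebra A S + T: Module.algebra A T
  for A :: "('a, 'm) ring_scheme" and S T :: "('a, 's, 'n) module_scheme" +
  fixes D :: "'s \<Rightarrow> 's"
  assumes inclusion_hom: "(\<lambda>f. f) \<in> ring_hom S T"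
    and inclusion_linear:
      "\<lbrakk>a \<in> carrier A; f \<in> carrier S\<rbrakk> \<Longrightarrow> a \<odot>\<^bsub>S\<^esub> f = a \<odot>\<^bsub>T\<^esub> f"
    and closed: "f \<in> carrier S \<Longrightarrow> D f \<in> carrier T"
    and additive: "\<lbrakk>f \<in> carrier S; g \<in> carrier S\<rbrakk> \<Longrightarrow> D (f \<oplus>\<^bsub>S\<^esub> g) = D f \<oplus>\<^bsub>T\<^esub> D g"
    and homogeneous: "\<lbrakk>a \<in> carrier A; f \<in> carrier S\<rbrakk> \<Longrightarrow> D (a \<odot>\<^bsub>S\<^esub> f) = a \<odot>\<^bsub>T\<^esub> D f"
    and leibniz: "\<lbrakk>f \<in> carrier S; g \<in> carrier S\<rbrakk> \<Longrightarrow>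
      D (f \<otimes>\<^bsub>S\<^esub> g) = f \<otimes>\<^bsub>T\<^esub> D g \<oplus>\<^bsub>T\<^esub> g \<otimes>\<^bsub>T\<^esub> D f"


section \<open>Sheaves on a topological space\<close>

text \<open>
  \<open>res U V\<close> is the restriction map from sections over \<open>U\<close> to sections over \<open>V \<subseteq> U\<close>.
  Only values at open sets matter. The empty cover is allowed, so there is exactly
  one section over the empty set.
\<close>
locale sheaf_of_sets =
  fixes F :: "'x::topological_space set \<Rightarrow> 'f set"
    and res :: "'x set \<Rightarrow> 'x set \<Rightarrow> 'f \<Rightarrow> 'f"
  assumes res_closed:
      "\<lbrakk>open U; open V; V \<subseteq> U; s \<in> F U\<rbrakk> \<Longrightarrow> res U V s \<in> F V"
    and res_id: "\<lbrakk>open U; s \<in> F U\<rbrakk> \<Longrightarrow> res U U s = s"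
    and res_comp:
      "\<lbrakk>open U; open V; open W; W \<subseteq> V; V \<subseteq> U; s \<in> F U\<rbrakk> \<Longrightarrow> res V W (res U V s) = res U W s"
    and locality:
      "\<lbrakk>\<And>V. V \<in> \<U> \<Longrightarrow> open V; s \<in> F (\<Union>\<U>); t \<in> F (\<Union>\<U>);
        \<And>V. V \<in> \<U> \<Longrightarrow> res (\<Union>\<U>) V s = res (\<Union>\<U>) V t\<rbrakk> \<Longrightarrow> s = t"
    and gluing:
      "\<lbrakk>\<And>V. V \<in> \<U> \<Longrightarrow> open V; \<And>V. V \<in> \<U> \<Longrightarrow> sec V \<in> F V;
        \<And>V W. \<lbrakk>V \<in> \<U>; W \<in> \<U>\<rbrakk> \<Longrightarrow> res V (V \<inter> W) (sec V) = res W (V \<inter> W) (sec W)\<rbrakk>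
       \<Longrightarrow> \<exists>s\<in>F (\<Union>\<U>). \<forall>V\<in>\<U>. res (\<Union>\<U>) V s = sec V"

locale sheaf_of_crings = sheaf_of_sets "\<lambda>U. carrier (R U)" res
  for R :: "'x::topological_space set \<Rightarrow> ('f, 'm) ring_scheme" and res +
  assumes cring_sections: "open U \<Longrightarrow> cring (R U)"
    and res_hom: "\<lbrakk>open U; open V; V \<subseteq> U\<rbrakk> \<Longrightarrow> res U V \<in> ring_hom (R U) (R V)"

text \<open>A sheaf of commutative algebras over the sheaf of rings \<open>\<O>\<close>.\<close>
locale sheaf_of_algebras = \<O>: sheaf_of_crings \<O> res\<O> + F: sheaf_of_crings F resF
  for \<O> :: "'x::topological_space set \<Rightarrow> ('r, 'm) ring_scheme" and res\<O>
    and F :: "'x set \<Rightarrow> ('r, 'f, 'n) module_scheme" and resF +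
  assumes algebra_sections: "open U \<Longrightarrow> Module.algebra (\<O> U) (F U)"
    and res_smult:
      "\<lbrakk>open U; open V; V \<subseteq> U; a \<in> carrier (\<O> U); f \<in> carrier (F U)\<rbrakk> \<Longrightarrow>
       resF U V (a \<odot>\<^bsub>F U\<^esub> f) = res\<O> U V a \<odot>\<^bsub>F V\<^esub> resF U V f"

text \<open>A sheaf of commutative algebras over a fixed ring \<open>A\<close>.\<close>
locale sheaf_of_algebras_over = F: sheaf_of_crings F res
  for A :: "('a, 'm) ring_scheme"
    and F :: "'x::topological_space set \<Rightarrow> ('a, 'f, 'n) module_scheme" and res +
  assumes algebra_sections: "open U \<Longrightarrow> Module.algebra A (F U)"
    and res_smult:
      "\<lbrakk>open U; open V; V \<subseteq> U; a \<in> carrier A; f \<in> carrier (F U)\<rbrakk> \<Longrightarrow>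
       res U V (a \<odot>\<^bsub>F U\<^esub> f) = a \<odot>\<^bsub>F V\<^esub> res U V f"

locale sheaf_derivation = sheaf_of_algebras_over A F res
  for A :: "('a, 'm) ring_scheme"
    and F :: "'x::topological_space set \<Rightarrow> ('a, 'f, 'n) module_scheme" and res +
  fixes D :: "'x set \<Rightarrow> 'f \<Rightarrow> 'f"
  assumes derivation_sections: "open U \<Longrightarrow> derivation A (F U) (D U)"
    and natural: "\<lbrakk>open U; open V; V \<subseteq> U; f \<in> carrier (F U)\<rbrakk> \<Longrightarrow>
      res U V (D U f) = D V (res U V f)"

locale sheaf_derivation_into =
  F: sheaf_of_algebras_over A F res + G: sheaf_of_algebras_over A G res
  for A :: "('a, 'm) ring_scheme"
    and F G :: "'x::topological_space set \<Rightarrow> ('a, 'f, 'n) module_scheme" and res +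
  fixes D :: "'x set \<Rightarrow> 'f \<Rightarrow> 'f"
  assumes derivation_sections: "open U \<Longrightarrow> derivation_into A (F U) (G U) (D U)"
    and natural: "\<lbrakk>open U; open V; V \<subseteq> U; f \<in> carrier (F U)\<rbrakk> \<Longrightarrow>
      res U V (D U f) = D V (res U V f)"


section \<open>Function rings on open sets\<close>

text \<open>
  Functions on \<open>U\<close> are represented by functions that are \<open>undefined\<close> outside \<open>U\<close>; \<open>P\<close> is the
  condition singling out the ring, and should not depend on values outside the open set \<open>U\<close>.
\<close>
definition fun_ring :: "('a \<Rightarrow> 'a) set \<Rightarrow> 'a set \<Rightarrow> ('a::real_normed_field \<Rightarrow> 'a) ring" where
  "fun_ring P U =
    \<lparr>carrier = extensional U \<inter> P,
     mult = (\<lambda>f g. \<lambda>z\<in>U. f z * g z),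
     one = (\<lambda>z\<in>U. 1),
     zero = (\<lambda>z\<in>U. 0),
     add = (\<lambda>f g. \<lambda>z\<in>U. f z + g z)\<rparr>"

definition all_ring :: "'a set \<Rightarrow> ('a::real_normed_field \<Rightarrow> 'a) ring" where
  "all_ring U = fun_ring UNIV U"

definition differentiable_ring :: "real set \<Rightarrow> (real \<Rightarrow> real) ring" where
  "differentiable_ring U = fun_ring {f. f differentiable_on U} U"

definition smooth_ring :: "real set \<Rightarrow> (real \<Rightarrow> real) ring" where
  "smooth_ring U = fun_ring {f. \<forall>k. (deriv ^^ k) f differentiable_on U} U"

definition holomorphic_ring :: "complex set \<Rightarrow> (complex \<Rightarrow> complex) ring" where
  "holomorphic_ring U = fun_ring {f. f holomorphic_on U} U"

definition fun_res :: "'a set \<Rightarrow> 'a set \<Rightarrow> ('a \<Rightarrow> 'b) \<Rightarrow> 'a \<Rightarrow> 'b" where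
  "fun_res U V f = restrict f V"


section \<open>Arithmetical functions with values in function rings\<close>

definition arith_res ::
    "'a set \<Rightarrow> 'a set \<Rightarrow> (nat \<Rightarrow> 'a \<Rightarrow> 'b) \<Rightarrow> nat \<Rightarrow> 'a \<Rightarrow> 'b" where
  "arith_res U V \<alpha> = (\<lambda>n\<in>pos_nats. fun_res U V (\<alpha> n))"

text \<open>
  The algebra \<open>F(N*, \<O>(U))\<close>, regarded as an algebra over the ground field \<open>'a\<close>, whose elements
  act as constant functions on \<open>U\<close>.
\<close>
definition arith_fun_algebra_const ::
    "('a set \<Rightarrow> ('a \<Rightarrow> 'a) ring) \<Rightarrow> 'a set \<Rightarrow> ('a, nat \<Rightarrow> 'a \<Rightarrow> 'a) module" where
  "arith_fun_algebra_const \<O> U = restrict_scalars (\<lambda>c. \<lambda>z\<in>U. c) (arith_fun_algebra (\<O> U))"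

definition D_tilde ::
    "'a::real_normed_field set \<Rightarrow> (nat \<Rightarrow> 'a \<Rightarrow> 'a) \<Rightarrow> nat \<Rightarrow> 'a \<Rightarrow> 'a" where
  "D_tilde U \<alpha> =
    (\<lambda>n\<in>pos_nats. \<lambda>z\<in>U. deriv (\<alpha> n) z - \<alpha> n z * of_real (ln (real n)))"

text \<open>
  The derivative of a differentiable real function need not be differentiable (for example
  \<open>x * \<bar>x\<bar>\<close>), so on differentiable functions \<open>D_tilde\<close> takes values in arithmetical functions
  over the larger ring \<^const>\<open>all_ring\<close>; it is a self-map over \<^const>\<open>smooth_ring\<close>
  and over \<^const>\<open>holomorphic_ring\<close>.
\<close>

end

theory Submission
  imports Defs
begin

text \<open>
  The arithmetical functions over any commutative ring form an algebra: associativity of the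
  convolution holds because both bracketings are the sum of \<open>\<alpha>(a) \<beta>(b) \<gamma>(c)\<close> over all
  factorisations \<open>n = a b c\<close> (\<open>dirichlet_triple\<close>). A family of restriction homomorphisms acts
  value by value, and the sheaf axioms for \<open>F(N*, R)\<close> are those of \<open>R\<close> at each positive integer
  (\<open>arith_fun_algebra_sheaf\<close>). Constant functions turn an algebra over the functions on \<open>U\<close> into an
  algebra over the ground field (\<open>restrict_scalars_sheaf\<close>).

  The Leibniz rule is a pointwise identity (\<open>D_tilde_derivation_into\<close>). At \<open>n\<close> and \<open>z\<close> a
  convolution is a finite sum of products \<open>\<alpha>(a)(z) \<beta>(b)(z)\<close> with \<open>a b = n\<close>. Differentiation in
  \<open>z\<close> obeys the product rule in each summand, and so does multiplication by the logarithm, because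
  \<open>log n = log a + log b\<close>. The difference of the two is then a derivation.

  This argument needs little of the functions themselves: that the class is local and closed under
  ring operations (the locale \<open>function_rings\<close>), that its members have derivatives, and that the
  derivatives lie in a class that contains the given one (the locale \<open>differential_function_rings\<close>).
  Differentiable functions with values among all functions, smooth functions and holomorphic
  functions are three such situations.
\<close>

section \<open>The algebra of arithmetical functions\<close>

text \<open>
  Factorisations of \<open>n\<close>, the index sets of convolutions. They are infinite for \<open>n = 0\<close>, but
  convolutions only involve positive \<open>n\<close>.
\<close>
abbreviation factor_pairs :: "nat \<Rightarrow> (nat \<times> nat) set" where
  "factor_pairs n \<equiv> {(a, b). a * b = n}"

abbreviation factor_triples :: "nat \<Rightarrow> (nat \<times> nat \<times> nat) set" where
  "factor_triples n \<equiv> {(a, b, c). a * b * c = n}"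

lemma finite_factor_pairs:
  assumes "n > 0"
  shows "finite (factor_pairs n)"
proof (rule finite_subset)
  show "factor_pairs n \<subseteq> {..n} \<times> {..n}"
    using assms by auto
qed simp

lemma (in abelian_monoid) finsum_Sigma:
  assumes "finite A" "\<And>x. x \<in> A \<Longrightarrow> finite (B x)"
    and "\<And>x y. \<lbrakk>x \<in> A; y \<in> B x\<rbrakk> \<Longrightarrow> f x y \<in> carrier G"
  shows "(\<Oplus>x\<in>A. \<Oplus>y\<in>B x. f x y) = (\<Oplus>p\<in>Sigma A B. f (fst p) (snd p))"
  using assms
proof (induction A rule: finite_induct)
  case empty
  then show ?case by simp
next
  case (insert x A)
  have eq: "Sigma (insert x A) B = Pair x ` B x \<union> Sigma A B"
    by auto
  have "(\<Oplus>p\<in>Sigma (insert x A) B. f (fst p) (snd p)) =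
      (\<Oplus>p\<in>Pair x ` B x. f (fst p) (snd p)) \<oplus> (\<Oplus>p\<in>Sigma A B. f (fst p) (snd p))"
    unfolding eq by (rule finsum_Un_disjoint) (use insert in auto)
  also have "(\<Oplus>p\<in>Pair x ` B x. f (fst p) (snd p)) = (\<Oplus>y\<in>B x. f x y)"
    by (subst finsum_reindex) (use insert in \<open>auto simp: inj_on_def\<close>)
  also have "(\<Oplus>p\<in>Sigma A B. f (fst p) (snd p)) = (\<Oplus>x\<in>A. \<Oplus>y\<in>B x. f x y)"
    using insert by simp
  also have "(\<Oplus>y\<in>B x. f x y) \<oplus> (\<Oplus>x\<in>A. \<Oplus>y\<in>B x. f x y) =
      (\<Oplus>x\<in>insert x A. \<Oplus>y\<in>B x. f x y)"
    by (rule finsum_insert[symmetric]) (use insert in \<open>auto intro!: finsum_closed\<close>)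
  finally show ?case ..
qed

lemma arith_fun_algebra_carrier:
  "carrier (arith_fun_algebra R) = pos_nats \<rightarrow>\<^sub>E carrier R"
  by (simp add: arith_fun_algebra_def)

lemma arith_fun_algebra_eval:
  assumes "n > 0"
  shows "(\<alpha> \<otimes>\<^bsub>arith_fun_algebra R\<^esub> \<beta>) n =
      (\<Oplus>\<^bsub>R\<^esub>p\<in>factor_pairs n. \<alpha> (fst p) \<otimes>\<^bsub>R\<^esub> \<beta> (snd p))"
    and "(\<alpha> \<oplus>\<^bsub>arith_fun_algebra R\<^esub> \<beta>) n = \<alpha> n \<oplus>\<^bsub>R\<^esub> \<beta> n"
    and "\<one>\<^bsub>arith_fun_algebra R\<^esub> n = (if n = 1 then \<one>\<^bsub>R\<^esub> else \<zero>\<^bsub>R\<^esub>)"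
    and "\<zero>\<^bsub>arith_fun_algebra R\<^esub> n = \<zero>\<^bsub>R\<^esub>"
    and "(r \<odot>\<^bsub>arith_fun_algebra R\<^esub> \<alpha>) n = r \<otimes>\<^bsub>R\<^esub> \<alpha> n"
  using assms by (simp_all add: arith_fun_algebra_def)

lemma arith_fun_eqI:
  assumes "\<alpha> \<in> carrier (arith_fun_algebra R)" "\<beta> \<in> carrier (arith_fun_algebra S)"
    and "\<And>n. n > 0 \<Longrightarrow> \<alpha> n = \<beta> n"
  shows "\<alpha> = \<beta>"
  using assms by (auto simp: arith_fun_algebra_carrier intro: PiE_ext)

lemma arith_fun_value:
  "\<lbrakk>\<alpha> \<in> carrier (arith_fun_algebra R); n > 0\<rbrakk> \<Longrightarrow> \<alpha> n \<in> carrier R"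
  by (auto simp: arith_fun_algebra_carrier)

context cring
begin

lemma arith_fun_products_closed:
  assumes "\<alpha> \<in> carrier (arith_fun_algebra R)" "\<beta> \<in> carrier (arith_fun_algebra R)" "n > 0"
  shows "(\<lambda>p. \<alpha> (fst p) \<otimes> \<beta> (snd p)) \<in> factor_pairs n \<rightarrow> carrier R"
  using assms(1,2)[THEN arith_fun_value] assms(3) by auto

lemma arith_fun_one_closed: "\<one>\<^bsub>arith_fun_algebra R\<^esub> \<in> carrier (arith_fun_algebra R)"
  and arith_fun_zero_closed: "\<zero>\<^bsub>arith_fun_algebra R\<^esub> \<in> carrier (arith_fun_algebra R)"
  by (auto simp: arith_fun_algebra_def)

lemma dirichlet_closed:
  assumes "\<alpha> \<in> carrier (arith_fun_algebra R)" "\<beta> \<in> carrier (arith_fun_algebra R)"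
  shows "\<alpha> \<otimes>\<^bsub>arith_fun_algebra R\<^esub> \<beta> \<in> carrier (arith_fun_algebra R)"
  using finsum_closed[OF arith_fun_products_closed[OF assms]]
  by (auto simp: arith_fun_algebra_def)

lemma arith_fun_add_closed:
  assumes "\<alpha> \<in> carrier (arith_fun_algebra R)" "\<beta> \<in> carrier (arith_fun_algebra R)"
  shows "\<alpha> \<oplus>\<^bsub>arith_fun_algebra R\<^esub> \<beta> \<in> carrier (arith_fun_algebra R)"
  using assms by (auto simp: arith_fun_algebra_def)

lemma arith_fun_smult_closed:
  assumes "r \<in> carrier R" "\<alpha> \<in> carrier (arith_fun_algebra R)"
  shows "r \<odot>\<^bsub>arith_fun_algebra R\<^esub> \<alpha> \<in> carrier (arith_fun_algebra R)"
  using assms by (auto simp: arith_fun_algebra_def)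

lemmas arith_fun_algebra_closed = arith_fun_one_closed arith_fun_zero_closed dirichlet_closed
  arith_fun_add_closed arith_fun_smult_closed

lemma dirichlet_comm:
  assumes "\<alpha> \<in> carrier (arith_fun_algebra R)" "\<beta> \<in> carrier (arith_fun_algebra R)"
  shows "\<alpha> \<otimes>\<^bsub>arith_fun_algebra R\<^esub> \<beta> = \<beta> \<otimes>\<^bsub>arith_fun_algebra R\<^esub> \<alpha>"
proof (rule arith_fun_eqI[of _ R _ R])
  fix n :: nat assume n: "n > 0"
  have swap: "factor_pairs n = prod.swap ` factor_pairs n"
    by (force simp: mult.commute image_iff)
  have "(\<Oplus>p\<in>factor_pairs n. \<alpha> (fst p) \<otimes> \<beta> (snd p)) =
      (\<Oplus>p\<in>prod.swap ` factor_pairs n. \<alpha> (fst p) \<otimes> \<beta> (snd p))"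
    using swap by simp
  also have "\<dots> = (\<Oplus>p\<in>factor_pairs n. \<alpha> (snd p) \<otimes> \<beta> (fst p))"
    using arith_fun_products_closed[OF assms n] swap by (subst finsum_reindex) auto
  also have "\<dots> = (\<Oplus>p\<in>factor_pairs n. \<beta> (fst p) \<otimes> \<alpha> (snd p))"
    using n assms by (intro finsum_cong') (auto intro!: m_comm assms[THEN arith_fun_value])
  finally show "(\<alpha> \<otimes>\<^bsub>arith_fun_algebra R\<^esub> \<beta>) n = (\<beta> \<otimes>\<^bsub>arith_fun_algebra R\<^esub> \<alpha>) n"
    using n by (simp add: arith_fun_algebra_eval)
qed (use assms arith_fun_algebra_closed in auto)

text \<open>
  The sum over triples treats the three factors alike, so it also gives the value of the other
  bracketing.
\<close>
lemma dirichlet_triple: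
  assumes "\<alpha> \<in> carrier (arith_fun_algebra R)" "\<beta> \<in> carrier (arith_fun_algebra R)"
    "\<gamma> \<in> carrier (arith_fun_algebra R)" and n: "n > 0"
  shows "((\<alpha> \<otimes>\<^bsub>arith_fun_algebra R\<^esub> \<beta>) \<otimes>\<^bsub>arith_fun_algebra R\<^esub> \<gamma>) n =
    (\<Oplus>t\<in>factor_triples n. \<alpha> (fst t) \<otimes> \<beta> (fst (snd t)) \<otimes> \<gamma> (snd (snd t)))"
proof -
  note vals = assms(1-3)[THEN arith_fun_value]
  let ?I = "Sigma (factor_pairs n) (\<lambda>p. factor_pairs (fst p))"
  let ?h = "\<lambda>(p :: nat \<times> nat, q :: nat \<times> nat). (fst q, snd q, snd p)"
  have inj: "inj_on ?h ?I"
    by (auto simp: inj_on_def)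
  have img: "?h ` ?I = factor_triples n"
    by (force simp: image_iff)
  have "((\<alpha> \<otimes>\<^bsub>arith_fun_algebra R\<^esub> \<beta>) \<otimes>\<^bsub>arith_fun_algebra R\<^esub> \<gamma>) n =
    (\<Oplus>p\<in>factor_pairs n. (\<alpha> \<otimes>\<^bsub>arith_fun_algebra R\<^esub> \<beta>) (fst p) \<otimes> \<gamma> (snd p))"
    using n by (rule arith_fun_algebra_eval)
  also have "\<dots> = (\<Oplus>p\<in>factor_pairs n. \<Oplus>q\<in>factor_pairs (fst p).
      \<alpha> (fst q) \<otimes> \<beta> (snd q) \<otimes> \<gamma> (snd p))"
  proof (rule finsum_cong')
    fix p assume p: "p \<in> factor_pairs n"
    then have pos: "fst p > 0" "snd p > 0"
      using n by (auto intro!: Nat.gr0I)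
    show "(\<alpha> \<otimes>\<^bsub>arith_fun_algebra R\<^esub> \<beta>) (fst p) \<otimes> \<gamma> (snd p) =
        (\<Oplus>q\<in>factor_pairs (fst p). \<alpha> (fst q) \<otimes> \<beta> (snd q) \<otimes> \<gamma> (snd p))"
      unfolding arith_fun_algebra_eval(1)[OF pos(1)]
      by (rule finsum_ldistr[OF finite_factor_pairs[OF pos(1)] vals(3)[OF pos(2)]
            arith_fun_products_closed[OF assms(1,2) pos(1)]])
  qed (use n in \<open>auto intro!: finsum_closed m_closed vals\<close>)
  also have "\<dots> = (\<Oplus>pq\<in>?I. \<alpha> (fst (snd pq)) \<otimes> \<beta> (snd (snd pq)) \<otimes> \<gamma> (snd (fst pq)))"
    using n by (intro finsum_Sigma finite_factor_pairs) (auto intro!: m_closed vals finite_factor_pairs)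
  also have "\<dots> = (\<Oplus>pq\<in>?I. 
      (\<lambda>t. \<alpha> (fst t) \<otimes> \<beta> (fst (snd t)) \<otimes> \<gamma> (snd (snd t))) (?h pq))"
    using n by (intro finsum_cong') (auto intro!: m_closed vals)
  also have "\<dots> = (\<Oplus>t\<in>?h ` ?I. \<alpha> (fst t) \<otimes> \<beta> (fst (snd t)) \<otimes> \<gamma> (snd (snd t)))"
    using n by (subst finsum_reindex[OF _ inj]) (auto intro!: m_closed vals)
  finally show ?thesis
    unfolding img .
qed

lemma dirichlet_assoc:
  assumes "\<alpha> \<in> carrier (arith_fun_algebra R)" "\<beta> \<in> carrier (arith_fun_algebra R)"
    "\<gamma> \<in> carrier (arith_fun_algebra R)"
  shows "(\<alpha> \<otimes>\<^bsub>arith_fun_algebra R\<^esub> \<beta>) \<otimes>\<^bsub>arith_fun_algebra R\<^esub> \<gamma> =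
    \<alpha> \<otimes>\<^bsub>arith_fun_algebra R\<^esub> (\<beta> \<otimes>\<^bsub>arith_fun_algebra R\<^esub> \<gamma>)"
proof (rule arith_fun_eqI[of _ R _ R])
  fix n :: nat assume n: "n > 0"
  note vals = assms(1-3)[THEN arith_fun_value]
  let ?h = "\<lambda>(a :: nat, b :: nat, c :: nat). (b, c, a)"
  have inj: "inj_on ?h (factor_triples n)"
    by (auto simp: inj_on_def)
  have img: "?h ` factor_triples n = factor_triples n"
    by (force simp: image_iff mult_ac)
  have "(\<alpha> \<otimes>\<^bsub>arith_fun_algebra R\<^esub> (\<beta> \<otimes>\<^bsub>arith_fun_algebra R\<^esub> \<gamma>)) n =
      ((\<beta> \<otimes>\<^bsub>arith_fun_algebra R\<^esub> \<gamma>) \<otimes>\<^bsub>arith_fun_algebra R\<^esub> \<alpha>) n"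
    using assms by (simp add: dirichlet_comm arith_fun_algebra_closed)
  also have "\<dots> = (\<Oplus>t\<in>?h ` factor_triples n. \<beta> (fst t) \<otimes> \<gamma> (fst (snd t)) \<otimes> \<alpha> (snd (snd t)))"
    unfolding img using assms n by (intro dirichlet_triple)
  also have "\<dots> = (\<Oplus>t\<in>factor_triples n.
      (\<lambda>t. \<beta> (fst t) \<otimes> \<gamma> (fst (snd t)) \<otimes> \<alpha> (snd (snd t))) (?h t))"
    using n by (subst finsum_reindex[OF _ inj]) (auto intro!: m_closed vals)
  also have "\<dots> = (\<Oplus>t\<in>factor_triples n. \<alpha> (fst t) \<otimes> \<beta> (fst (snd t)) \<otimes> \<gamma> (snd (snd t)))"
    using n by (intro finsum_cong') (auto simp: vals m_ac)
  also have "\<dots> = ((\<alpha> \<otimes>\<^bsub>arith_fun_algebra R\<^esub> \<beta>) \<otimes>\<^bsub>arith_fun_algebra R\<^esub> \<gamma>) n"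
    using dirichlet_triple[OF assms n] ..
  finally show "((\<alpha> \<otimes>\<^bsub>arith_fun_algebra R\<^esub> \<beta>) \<otimes>\<^bsub>arith_fun_algebra R\<^esub> \<gamma>) n =
    (\<alpha> \<otimes>\<^bsub>arith_fun_algebra R\<^esub> (\<beta> \<otimes>\<^bsub>arith_fun_algebra R\<^esub> \<gamma>)) n" ..
qed (use assms arith_fun_algebra_closed in auto)

lemma dirichlet_one:
  assumes "\<alpha> \<in> carrier (arith_fun_algebra R)"
  shows "\<one>\<^bsub>arith_fun_algebra R\<^esub> \<otimes>\<^bsub>arith_fun_algebra R\<^esub> \<alpha> = \<alpha>"
proof (rule arith_fun_eqI[of _ R _ R])
  fix n :: nat assume n: "n > 0"
  have "(\<Oplus>p\<in>factor_pairs n. \<one>\<^bsub>arith_fun_algebra R\<^esub> (fst p) \<otimes> \<alpha> (snd p)) =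
      (\<Oplus>p\<in>factor_pairs n. if p = (1, n) then \<alpha> (snd p) else \<zero>)"
  proof (rule finsum_cong')
    fix p assume p: "p \<in> factor_pairs n"
    then have pos: "fst p > 0" "snd p > 0"
      using n by (auto intro!: Nat.gr0I)
    have "p = (1, n) \<longleftrightarrow> fst p = 1"
      using p by (cases p) auto
    then show "\<one>\<^bsub>arith_fun_algebra R\<^esub> (fst p) \<otimes> \<alpha> (snd p) =
        (if p = (1, n) then \<alpha> (snd p) else \<zero>)"
      using arith_fun_value[OF assms pos(2)] arith_fun_algebra_eval(3)[OF pos(1), of R] by simp
  next
    show "(\<lambda>p. if p = (1, n) then \<alpha> (snd p) else \<zero>) \<in> factor_pairs n \<rightarrow> carrier R"
      using arith_fun_value[OF assms n] by simp
  qed simp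
  also have "\<dots> = \<alpha> (snd (1 :: nat, n))"
  proof (rule add.finprod_singleton_swap)
    show "(\<lambda>p. \<alpha> (snd p)) \<in> factor_pairs n \<rightarrow> carrier R"
      using arith_fun_value[OF assms] n by auto
  qed (use n finite_factor_pairs in auto)
  finally show "(\<one>\<^bsub>arith_fun_algebra R\<^esub> \<otimes>\<^bsub>arith_fun_algebra R\<^esub> \<alpha>) n = \<alpha> n"
    using n by (simp add: arith_fun_algebra_eval(1))
qed (use assms arith_fun_algebra_closed in auto)

lemma dirichlet_l_distr:
  assumes "\<alpha> \<in> carrier (arith_fun_algebra R)" "\<beta> \<in> carrier (arith_fun_algebra R)"
    "\<gamma> \<in> carrier (arith_fun_algebra R)"
  shows "(\<alpha> \<oplus>\<^bsub>arith_fun_algebra R\<^esub> \<beta>) \<otimes>\<^bsub>arith_fun_algebra R\<^esub> \<gamma> =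
    \<alpha> \<otimes>\<^bsub>arith_fun_algebra R\<^esub> \<gamma> \<oplus>\<^bsub>arith_fun_algebra R\<^esub> \<beta> \<otimes>\<^bsub>arith_fun_algebra R\<^esub> \<gamma>"
proof (rule arith_fun_eqI[of _ R _ R])
  fix n :: nat assume n: "n > 0"
  note vals = assms(1-3)[THEN arith_fun_value]
  have "((\<alpha> \<oplus>\<^bsub>arith_fun_algebra R\<^esub> \<beta>) \<otimes>\<^bsub>arith_fun_algebra R\<^esub> \<gamma>) n =
      (\<Oplus>p\<in>factor_pairs n. \<alpha> (fst p) \<otimes> \<gamma> (snd p) \<oplus> \<beta> (fst p) \<otimes> \<gamma> (snd p))"
    unfolding arith_fun_algebra_eval(1)[OF n] using n
    by (intro finsum_cong') (auto simp: arith_fun_algebra_eval vals intro!: l_distr)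
  also have "\<dots> = (\<Oplus>p\<in>factor_pairs n. \<alpha> (fst p) \<otimes> \<gamma> (snd p)) \<oplus>
      (\<Oplus>p\<in>factor_pairs n. \<beta> (fst p) \<otimes> \<gamma> (snd p))"
    by (intro finsum_addf arith_fun_products_closed assms n)
  finally show "((\<alpha> \<oplus>\<^bsub>arith_fun_algebra R\<^esub> \<beta>) \<otimes>\<^bsub>arith_fun_algebra R\<^esub> \<gamma>) n =
    (\<alpha> \<otimes>\<^bsub>arith_fun_algebra R\<^esub> \<gamma> \<oplus>\<^bsub>arith_fun_algebra R\<^esub>
      \<beta> \<otimes>\<^bsub>arith_fun_algebra R\<^esub> \<gamma>) n"
    using n by (simp add: arith_fun_algebra_eval)
qed (use assms arith_fun_algebra_closed in auto)

lemma dirichlet_smult: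
  assumes "r \<in> carrier R" "\<alpha> \<in> carrier (arith_fun_algebra R)"
    "\<beta> \<in> carrier (arith_fun_algebra R)"
  shows "(r \<odot>\<^bsub>arith_fun_algebra R\<^esub> \<alpha>) \<otimes>\<^bsub>arith_fun_algebra R\<^esub> \<beta> =
    r \<odot>\<^bsub>arith_fun_algebra R\<^esub> (\<alpha> \<otimes>\<^bsub>arith_fun_algebra R\<^esub> \<beta>)"
proof (rule arith_fun_eqI[of _ R _ R])
  fix n :: nat assume n: "n > 0"
  note vals = assms(2-3)[THEN arith_fun_value]
  have "(r \<odot>\<^bsub>arith_fun_algebra R\<^esub> (\<alpha> \<otimes>\<^bsub>arith_fun_algebra R\<^esub> \<beta>)) n =
      (\<Oplus>p\<in>factor_pairs n. r \<otimes> (\<alpha> (fst p) \<otimes> \<beta> (snd p)))"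
    unfolding arith_fun_algebra_eval[OF n]
    by (intro finsum_rdistr finite_factor_pairs arith_fun_products_closed assms n)
  also have "\<dots> = ((r \<odot>\<^bsub>arith_fun_algebra R\<^esub> \<alpha>) \<otimes>\<^bsub>arith_fun_algebra R\<^esub> \<beta>) n"
    unfolding arith_fun_algebra_eval(1)[OF n] using n assms(1)
    by (intro finsum_cong') (auto simp: arith_fun_algebra_eval vals m_assoc)
  finally show "((r \<odot>\<^bsub>arith_fun_algebra R\<^esub> \<alpha>) \<otimes>\<^bsub>arith_fun_algebra R\<^esub> \<beta>) n =
    (r \<odot>\<^bsub>arith_fun_algebra R\<^esub> (\<alpha> \<otimes>\<^bsub>arith_fun_algebra R\<^esub> \<beta>)) n" ..
qed (use assms arith_fun_algebra_closed in auto)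

lemma arith_fun_algebra_abelian_group: "abelian_group (arith_fun_algebra R)"
proof (rule abelian_groupI)
  fix \<alpha> assume \<alpha>: "\<alpha> \<in> carrier (arith_fun_algebra R)"
  show "\<exists>\<beta>\<in>carrier (arith_fun_algebra R). \<beta> \<oplus>\<^bsub>arith_fun_algebra R\<^esub> \<alpha> =
      \<zero>\<^bsub>arith_fun_algebra R\<^esub>"
    using arith_fun_value[OF \<alpha>] by (intro bexI[of _ "\<lambda>n\<in>pos_nats. \<ominus> \<alpha> n"])
      (auto simp: arith_fun_algebra_def l_neg)
qed (rule arith_fun_algebra_closed arith_fun_eqI[of _ R _ R]
    | simp add: arith_fun_algebra_closed arith_fun_algebra_eval arith_fun_value a_ac)+

lemma arith_fun_algebra_cring: "cring (arith_fun_algebra R)"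
  by (intro cringI arith_fun_algebra_abelian_group comm_monoidI)
    (assumption | rule arith_fun_algebra_closed dirichlet_assoc dirichlet_comm dirichlet_one
      dirichlet_l_distr)+

lemma arith_fun_algebra_algebra: "Module.algebra R (arith_fun_algebra R)"
proof (intro algebraI arith_fun_algebra_cring cring_axioms)
  fix a \<alpha> \<beta>
  assume "a \<in> carrier R" "\<alpha> \<in> carrier (arith_fun_algebra R)" "\<beta> \<in> carrier (arith_fun_algebra R)"
  then show "(a \<odot>\<^bsub>arith_fun_algebra R\<^esub> \<alpha>) \<otimes>\<^bsub>arith_fun_algebra R\<^esub> \<beta> =
      a \<odot>\<^bsub>arith_fun_algebra R\<^esub> (\<alpha> \<otimes>\<^bsub>arith_fun_algebra R\<^esub> \<beta>)"
    by (rule dirichlet_smult)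
qed (rule arith_fun_algebra_closed arith_fun_eqI[of _ R _ R]
    | simp add: arith_fun_algebra_closed arith_fun_algebra_eval arith_fun_value
        m_assoc l_distr r_distr)+

end

section \<open>Sheaves of arithmetical functions\<close>

lemma arith_fun_map_ring_hom:
  assumes "cring R" "cring S" "h \<in> ring_hom R S"
  shows "(\<lambda>\<alpha>. \<lambda>n\<in>pos_nats. h (\<alpha> n)) \<in> ring_hom (arith_fun_algebra R) (arith_fun_algebra S)"
proof -
  interpret R: cring R by fact
  interpret S: cring S by fact
  interpret h: ring_hom_cring R S h
    using assms by (auto simp: ring_hom_cring_def ring_hom_cring_axioms_def)
  let ?H = "\<lambda>\<alpha>. \<lambda>n\<in>pos_nats. h (\<alpha> n)"
  have closed: "?H \<alpha> \<in> carrier (arith_fun_algebra S)" if "\<alpha> \<in> carrier (arith_fun_algebra R)" for \<alpha>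
    using that by (auto simp: arith_fun_algebra_carrier)
  show ?thesis
  proof (rule ring_hom_memI)
    fix \<alpha> \<beta>
    assume \<alpha>\<beta>: "\<alpha> \<in> carrier (arith_fun_algebra R)" "\<beta> \<in> carrier (arith_fun_algebra R)"
    note vals = \<alpha>\<beta>[THEN arith_fun_value]
    show "?H (\<alpha> \<otimes>\<^bsub>arith_fun_algebra R\<^esub> \<beta>) = ?H \<alpha> \<otimes>\<^bsub>arith_fun_algebra S\<^esub> ?H \<beta>"
    proof (rule arith_fun_eqI[of _ S _ S])
      fix n :: nat assume n: "n > 0"
      have "h ((\<alpha> \<otimes>\<^bsub>arith_fun_algebra R\<^esub> \<beta>) n) =
          (\<Oplus>\<^bsub>S\<^esub>p\<in>factor_pairs n. h (\<alpha> (fst p) \<otimes>\<^bsub>R\<^esub> \<beta> (snd p)))"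
        using R.arith_fun_products_closed[OF \<alpha>\<beta> n] n
        by (simp add: arith_fun_algebra_eval h.hom_finsum comp_def)
      also have "\<dots> = (\<Oplus>\<^bsub>S\<^esub>p\<in>factor_pairs n. ?H \<alpha> (fst p) \<otimes>\<^bsub>S\<^esub> ?H \<beta> (snd p))"
        using n by (intro S.finsum_cong') (auto simp: vals)
      finally show "?H (\<alpha> \<otimes>\<^bsub>arith_fun_algebra R\<^esub> \<beta>) n =
          (?H \<alpha> \<otimes>\<^bsub>arith_fun_algebra S\<^esub> ?H \<beta>) n"
        unfolding arith_fun_algebra_eval(1)[OF n, of S] using n by simp
    qed (intro closed R.arith_fun_algebra_closed S.arith_fun_algebra_closed \<alpha>\<beta>)+
    show "?H (\<alpha> \<oplus>\<^bsub>arith_fun_algebra R\<^esub> \<beta>) = ?H \<alpha> \<oplus>\<^bsub>arith_fun_algebra S\<^esub> ?H \<beta>"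
      by (rule arith_fun_eqI[of _ S _ S],
          (intro closed R.arith_fun_algebra_closed S.arith_fun_algebra_closed \<alpha>\<beta>)+)
        (simp add: arith_fun_algebra_eval vals)
    show "?H \<alpha> \<in> carrier (arith_fun_algebra S)"
      using \<alpha>\<beta>(1) by (rule closed)
  qed (auto simp: arith_fun_algebra_def)
qed

lemma arith_fun_algebra_sheaf:
  assumes "sheaf_of_crings R res"
  shows "sheaf_of_algebras R res (\<lambda>U. arith_fun_algebra (R U))
    (\<lambda>U V \<alpha>. \<lambda>n\<in>pos_nats. res U V (\<alpha> n))"
proof -
  interpret R: sheaf_of_crings R res by fact
  let ?F = "\<lambda>U. arith_fun_algebra (R U)"
  let ?res = "\<lambda>U V \<alpha>. \<lambda>n\<in>pos_nats. res U V (\<alpha> n)"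
  note [simp] = arith_fun_algebra_carrier
  have sets: "sheaf_of_sets (\<lambda>U. carrier (?F U)) ?res"
  proof
    fix U V s assume "open U" "open V" "V \<subseteq> U" "s \<in> carrier (?F U)"
    then show "?res U V s \<in> carrier (?F V)"
      by (auto intro!: R.res_closed)
  next
    fix U s assume "open U" "s \<in> carrier (?F U)"
    then show "?res U U s = s"
      by (auto simp: fun_eq_iff R.res_id PiE_iff extensional_def)
  next
    fix U V W s
    assume "open U" "open V" "open W" "W \<subseteq> V" "V \<subseteq> U" "s \<in> carrier (?F U)"
    then show "?res V W (?res U V s) = ?res U W s"
      by (auto simp: fun_eq_iff PiE_iff R.res_comp)
  next
    fix \<U> s t
    assume op: "\<And>V. V \<in> \<U> \<Longrightarrow> open V"
      and st: "s \<in> carrier (?F (\<Union>\<U>))" "t \<in> carrier (?F (\<Union>\<U>))"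
      and eq: "\<And>V. V \<in> \<U> \<Longrightarrow> ?res (\<Union>\<U>) V s = ?res (\<Union>\<U>) V t"
    show "s = t"
    proof (rule arith_fun_eqI[OF st])
      fix n :: nat assume n: "n > 0"
      show "s n = t n"
      proof (rule R.locality)
        fix V assume "V \<in> \<U>"
        from fun_cong[OF eq[OF this], of n] n
        show "res (\<Union>\<U>) V (s n) = res (\<Union>\<U>) V (t n)" by simp
      qed (use op st n in auto)
    qed
  next
    fix \<U> sec
    assume op: "\<And>V. V \<in> \<U> \<Longrightarrow> open V"
      and sec: "\<And>V. V \<in> \<U> \<Longrightarrow> sec V \<in> carrier (?F V)"
      and eq: "\<And>V W. \<lbrakk>V \<in> \<U>; W \<in> \<U>\<rbrakk> \<Longrightarrow> ?res V (V \<inter> W) (sec V) = ?res W (V \<inter> W) (sec W)"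
    have "\<exists>s\<in>carrier (R (\<Union>\<U>)). \<forall>V\<in>\<U>. res (\<Union>\<U>) V s = sec V n" if n: "n > 0" for n
    proof (rule R.gluing)
      fix V W assume "V \<in> \<U>" "W \<in> \<U>"
      from fun_cong[OF eq[OF this], of n] n
      show "res V (V \<inter> W) (sec V n) = res W (V \<inter> W) (sec W n)" by simp
    qed (use op arith_fun_value[OF sec n] in auto)
    then obtain s where s: "\<And>n. n > 0 \<Longrightarrow> s n \<in> carrier (R (\<Union>\<U>))"
      "\<And>n V. n > 0 \<Longrightarrow> V \<in> \<U> \<Longrightarrow> res (\<Union>\<U>) V (s n) = sec V n"
      by metis
    show "\<exists>s\<in>carrier (?F (\<Union>\<U>)). \<forall>V\<in>\<U>. ?res (\<Union>\<U>) V s = sec V"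
    proof (intro bexI[of _ "restrict s pos_nats"] ballI)
      fix V assume V: "V \<in> \<U>"
      show "?res (\<Union>\<U>) V (restrict s pos_nats) = sec V"
        using sec[OF V] s(2)[OF _ V] by (auto simp: fun_eq_iff PiE_iff extensional_def)
    qed (use s(1) in auto)
  qed
  have crings: "sheaf_of_crings ?F ?res"
    using sets
    by (auto simp: sheaf_of_crings_def sheaf_of_crings_axioms_def
        intro!: cring.arith_fun_algebra_cring arith_fun_map_ring_hom R.cring_sections R.res_hom)
  show ?thesis
  proof (intro sheaf_of_algebras.intro sheaf_of_algebras_axioms.intro assms crings)
    fix U :: "'a set" assume "open U"
    then show "Module.algebra (R U) (?F U)"
      by (intro cring.arith_fun_algebra_algebra R.cring_sections)
  next
    fix U V a f
    assume *: "open U" "open V" "V \<subseteq> U" "a \<in> carrier (R U)" "f \<in> carrier (?F U)"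
    have hom: "res U V \<in> ring_hom (R U) (R V)"
      using * by (intro R.res_hom)
    show "?res U V (a \<odot>\<^bsub>?F U\<^esub> f) = res U V a \<odot>\<^bsub>?F V\<^esub> ?res U V f"
      using * by (auto simp: arith_fun_algebra_def fun_eq_iff intro!: ring_hom_mult[OF hom])
  qed
qed

section \<open>Restriction of scalars\<close>

lemma restrict_scalars_simps [simp]:
  "carrier (restrict_scalars \<phi> S) = carrier S"
  "mult (restrict_scalars \<phi> S) = mult S"
  "one (restrict_scalars \<phi> S) = one S"
  "zero (restrict_scalars \<phi> S) = zero S"
  "add (restrict_scalars \<phi> S) = add S"
  "smult (restrict_scalars \<phi> S) c x = smult S (\<phi> c) x"
  by (simp_all add: restrict_scalars_def)

lemma restrict_scalars_cring:
  assumes "cring S"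
  shows "cring (restrict_scalars \<phi> S)"
proof -
  interpret S: cring S by fact
  show ?thesis
    by (intro cringI abelian_groupI comm_monoidI)
      (auto simp: S.m_ac S.a_ac S.l_distr S.r_distr intro: S.add.l_inv_ex)
qed

lemma restrict_scalars_algebra:
  assumes "cring A" "\<phi> \<in> ring_hom A R" "Module.algebra R S"
  shows "Module.algebra A (restrict_scalars \<phi> S)"
proof -
  interpret A: cring A by fact
  interpret algebra R S by fact
  have \<phi>: "\<And>a. a \<in> carrier A \<Longrightarrow> \<phi> a \<in> carrier R"
    using assms(2) by (rule ring_hom_closed)
  show ?thesis
    using ring_hom_add[OF assms(2)] ring_hom_mult[OF assms(2)] ring_hom_one[OF assms(2)]
    by (intro algebraI restrict_scalars_cring M_cring assms(1))
      (auto simp: \<phi> smult_l_distr smult_r_distr smult_assoc1 smult_assoc2)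
qed

lemma restrict_scalars_sheaf:
  assumes "sheaf_of_algebras \<O> res\<O> F resF" "cring A"
    and hom: "\<And>U. open U \<Longrightarrow> \<phi> U \<in> ring_hom A (\<O> U)"
    and compat: "\<And>U V a. \<lbrakk>open U; open V; V \<subseteq> U; a \<in> carrier A\<rbrakk> \<Longrightarrow> res\<O> U V (\<phi> U a) = \<phi> V a"
  shows "sheaf_of_algebras_over A (\<lambda>U. restrict_scalars (\<phi> U) (F U)) resF"
proof -
  interpret sheaf_of_algebras \<O> res\<O> F resF by fact
  let ?G = "\<lambda>U. restrict_scalars (\<phi> U) (F U)"
  have "sheaf_of_crings ?G resF"
  proof (intro sheaf_of_crings.intro sheaf_of_crings_axioms.intro)
    show "sheaf_of_sets (\<lambda>U. carrier (?G U)) resF"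
      using F.sheaf_of_sets_axioms by simp
    fix U :: "'a set" assume "open U"
    then show "cring (?G U)"
      by (intro restrict_scalars_cring F.cring_sections)
  next
    fix U V :: "'a set" assume "open U" "open V" "V \<subseteq> U"
    from F.res_hom[OF this] show "resF U V \<in> ring_hom (?G U) (?G V)"
      by (simp add: ring_hom_def)
  qed
  then show ?thesis
  proof (intro sheaf_of_algebras_over.intro sheaf_of_algebras_over_axioms.intro)
    fix U :: "'a set" assume "open U"
    then show "Module.algebra A (?G U)"
      by (intro restrict_scalars_algebra[OF assms(2) hom algebra_sections])
  next
    fix U V a f
    assume *: "open U" "open V" "V \<subseteq> U" "a \<in> carrier A" "f \<in> carrier (?G U)"
    then show "resF U V (a \<odot>\<^bsub>?G U\<^esub> f) = a \<odot>\<^bsub>?G V\<^esub> resF U V f"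
      using ring_hom_closed[OF hom[OF *(1)] *(4)] by (simp add: res_smult compat)
  qed
qed

section \<open>Derivations with values in the algebra itself\<close>

lemma derivation_into_self:
  assumes "derivation_into A S S D"
  shows "derivation A S D"
proof -
  interpret derivation_into A S S D by fact
  show ?thesis
    by (intro derivation.intro derivation_axioms.intro S.algebra_axioms closed additive
        homogeneous leibniz)
qed

lemma sheaf_derivation_into_self:
  assumes "sheaf_derivation_into A F F res D"
  shows "sheaf_derivation A F res D"
proof -
  interpret sheaf_derivation_into A F F res D by fact
  show ?thesis
    by (intro sheaf_derivation.intro sheaf_derivation_axioms.intro natural
        F.sheaf_of_algebras_over_axioms derivation_into_self derivation_sections)
qed

section \<open>Local classes of functions\<close>

lemma deriv_transform_within_open:
  assumes "open U" "z \<in> U" "\<And>w. w \<in> U \<Longrightarrow> f w = g w"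
  shows "deriv f z = deriv g z"
  using assms by (intro deriv_cong_ev) (auto simp: eventually_nhds)

text \<open>
  A subsheaf of rings, containing the constants, of the sheaf of all functions. Here \<open>P U\<close> consists
  of total functions, and \<open>cong\<close> says that their values outside \<open>U\<close> do not matter, so that
  truncation to \<open>U\<close> stays in \<open>P U\<close>. The axiom \<open>union\<close> says that membership is a local property.
\<close>
locale function_rings =
  fixes P :: "'a::real_normed_field set \<Rightarrow> ('a \<Rightarrow> 'a) set"
  assumes cong: "\<lbrakk>open U; f \<in> P U; \<And>z. z \<in> U \<Longrightarrow> g z = f z\<rbrakk> \<Longrightarrow> g \<in> P U"
    and mono: "\<lbrakk>open U; open V; V \<subseteq> U; f \<in> P U\<rbrakk> \<Longrightarrow> f \<in> P V"
    and union: "\<lbrakk>\<And>V. V \<in> \<U> \<Longrightarrow> open V; \<And>V. V \<in> \<U> \<Longrightarrow> f \<in> P V\<rbrakk> \<Longrightarrow> f \<in> P (\<Union>\<U>)"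
    and const: "open U \<Longrightarrow> (\<lambda>z. c) \<in> P U"
    and add: "\<lbrakk>open U; f \<in> P U; g \<in> P U\<rbrakk> \<Longrightarrow> (\<lambda>z. f z + g z) \<in> P U"
    and mult: "\<lbrakk>open U; f \<in> P U; g \<in> P U\<rbrakk> \<Longrightarrow> (\<lambda>z. f z * g z) \<in> P U"
begin

text \<open>
  The ring of members of the class over \<open>U\<close>, truncated to \<open>U\<close>, and the arithmetical functions
  with values in it as an algebra over the ground field.
\<close>
abbreviation sections :: "'a set \<Rightarrow> ('a \<Rightarrow> 'a) ring" where
  "sections U \<equiv> fun_ring (P U) U"

abbreviation arith_sections :: "'a set \<Rightarrow> ('a, nat \<Rightarrow> 'a \<Rightarrow> 'a) module" where
  "arith_sections \<equiv> arith_fun_algebra_const sections"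

lemma restrict_mem:
  assumes "open U" "f \<in> P U"
  shows "restrict f U \<in> P U"
  using assms by (rule cong) simp

lemma sections_cring:
  assumes "open U"
  shows "cring (sections U)"
proof (intro cringI abelian_groupI comm_monoidI)
  fix f assume f: "f \<in> carrier (sections U)"
  \<comment> \<open>negation is multiplication by the constant \<open>-1\<close>\<close>
  then have "(\<lambda>z. -1 * f z) \<in> P U"
    using assms by (intro mult const) (auto simp: fun_ring_def)
  then have "(\<lambda>z\<in>U. -1 * f z) \<in> carrier (sections U)"
    using assms by (simp add: fun_ring_def restrict_mem)
  then show "\<exists>g\<in>carrier (sections U). g \<oplus>\<^bsub>sections U\<^esub> f = \<zero>\<^bsub>sections U\<^esub>"
    by (rule bexI[rotated]) (auto simp: fun_ring_def)
qed (use assms in \<open>auto simp: fun_ring_def algebra_simps extensional_def fun_eq_iff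
      intro!: restrict_mem add mult const\<close>)

lemma sections_sheaf: "sheaf_of_crings sections fun_res"
proof (intro sheaf_of_crings.intro sheaf_of_crings_axioms.intro)
  have mem: "f \<in> carrier (sections U) \<longleftrightarrow> f \<in> extensional U \<and> f \<in> P U" for f U
    by (simp add: fun_ring_def)
  show "sheaf_of_sets (\<lambda>U. carrier (sections U)) fun_res"
  proof
    fix U V s assume "open U" "open V" "V \<subseteq> U" "s \<in> carrier (sections U)"
    then show "fun_res U V s \<in> carrier (sections V)"
      using mono[of U V s] by (simp add: mem fun_res_def restrict_mem)
  next
    fix U s assume "open U" "s \<in> carrier (sections U)"
    then show "fun_res U U s = s"
      by (simp add: mem fun_res_def extensional_restrict)
  next
    fix U V W s
    assume "W \<subseteq> V"
    then show "fun_res V W (fun_res U V s) = fun_res U W s"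
      by (simp add: fun_res_def Int_absorb1)
  next
    fix \<U> s t
    assume st: "s \<in> carrier (sections (\<Union>\<U>))" "t \<in> carrier (sections (\<Union>\<U>))"
      and eq: "\<And>V. V \<in> \<U> \<Longrightarrow> fun_res (\<Union>\<U>) V s = fun_res (\<Union>\<U>) V t"
    show "s = t"
    proof (rule extensionalityI)
      fix z assume "z \<in> \<Union>\<U>"
      then obtain V where "V \<in> \<U>" "z \<in> V" by blast
      with fun_cong[OF eq, of V z] show "s z = t z"
        by (simp add: fun_res_def)
    qed (use st mem in auto)
  next
    fix \<U> sec
    assume op: "\<And>V. V \<in> \<U> \<Longrightarrow> open V"
      and sec: "\<And>V. V \<in> \<U> \<Longrightarrow> sec V \<in> carrier (sections V)"
      and eq: "\<And>V W. \<lbrakk>V \<in> \<U>; W \<in> \<U>\<rbrakk> \<Longrightarrow> fun_res V (V \<inter> W) (sec V) = fun_res W (V \<inter> W) (sec W)"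
    \<comment> \<open>any member of the cover containing \<open>z\<close> may be used, since the sections agree on overlaps\<close>
    define s where "s = (\<lambda>z\<in>\<Union>\<U>. sec (SOME V. V \<in> \<U> \<and> z \<in> V) z)"
    have s: "s z = sec V z" if V: "V \<in> \<U>" "z \<in> V" for V z
    proof -
      define W where "W = (SOME W. W \<in> \<U> \<and> z \<in> W)"
      have W: "W \<in> \<U>" "z \<in> W"
        using someI[of "\<lambda>W. W \<in> \<U> \<and> z \<in> W" V] V unfolding W_def by auto
      have "s z = sec W z"
        using V by (auto simp: s_def W_def)
      also have "\<dots> = sec V z"
        using fun_cong[OF eq[OF V(1) W(1)], of z] V W by (simp add: fun_res_def)
      finally show ?thesis .
    qed
    show "\<exists>s\<in>carrier (sections (\<Union>\<U>)). \<forall>V\<in>\<U>. fun_res (\<Union>\<U>) V s = sec V"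
    proof (intro bexI[of _ s] ballI)
      fix V assume V: "V \<in> \<U>"
      show "fun_res (\<Union>\<U>) V s = sec V"
        using sec[OF V] s[OF V] by (auto simp: mem fun_res_def fun_eq_iff extensional_def)
    next
      have "s \<in> P V" if "V \<in> \<U>" for V
        using cong[OF op[OF that], of "sec V" s] sec[OF that] s[OF that] mem by simp
      then show "s \<in> carrier (sections (\<Union>\<U>))"
        using union[of \<U> s] op by (simp add: mem s_def)
    qed
  qed
  fix U V :: "'a set"
  assume "open U" "open V" "V \<subseteq> U"
  then show "fun_res U V \<in> ring_hom (sections U) (sections V)"
    using mono[of U V] by (auto intro!: ring_hom_memI restrict_mem
        simp: fun_ring_def fun_res_def fun_eq_iff subset_iff)
qed (rule sections_cring)

lemma constants_hom:
  assumes "open U"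
  shows "(\<lambda>c. \<lambda>z\<in>U. c) \<in> ring_hom ring_of_type_algebra (sections U)"
  using assms
  by (auto intro!: ring_hom_memI restrict_mem const simp: ring_of_type_algebra_def fun_ring_def)

lemma arith_sheaf:
  "sheaf_of_algebras sections fun_res (\<lambda>U. arith_fun_algebra (sections U)) arith_res"
proof -
  have "arith_res = (\<lambda>U V (\<alpha> :: nat \<Rightarrow> 'a \<Rightarrow> 'a). \<lambda>n\<in>pos_nats. fun_res U V (\<alpha> n))"
    by (intro ext) (simp add: arith_res_def)
  then show ?thesis
    using arith_fun_algebra_sheaf[OF sections_sheaf] by simp
qed

lemma arith_sheaf_const:
  "sheaf_of_algebras_over ring_of_type_algebra arith_sections arith_res"
proof -
  have "sheaf_of_algebras_over ring_of_type_algebra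
      (\<lambda>U. restrict_scalars (\<lambda>c. \<lambda>z\<in>U. c) (arith_fun_algebra (sections U))) arith_res"
    by (rule restrict_scalars_sheaf[OF arith_sheaf cring_from_type_algebra constants_hom])
      (simp_all add: fun_res_def Int_absorb1)
  then show ?thesis
    by (simp add: arith_fun_algebra_const_def[abs_def])
qed

lemma arith_algebra_const:
  "open U \<Longrightarrow> Module.algebra ring_of_type_algebra (arith_sections U)"
  using arith_sheaf_const by (rule sheaf_of_algebras_over.algebra_sections)

lemma arith_sections_carrier:
  "carrier (arith_sections U) = pos_nats \<rightarrow>\<^sub>E (extensional U \<inter> P U)"
  by (simp add: arith_fun_algebra_const_def arith_fun_algebra_carrier fun_ring_def)

lemma arith_sections_value:
  "\<lbrakk>\<alpha> \<in> carrier (arith_sections U); n > 0\<rbrakk> \<Longrightarrow> \<alpha> n \<in> P U"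
  by (auto simp: arith_sections_carrier)

lemma arith_sections_eqI:
  assumes "\<alpha> \<in> carrier (arith_sections U)" "\<beta> \<in> carrier (arith_sections U)"
    and "\<And>n z. \<lbrakk>n > 0; z \<in> U\<rbrakk> \<Longrightarrow> \<alpha> n z = \<beta> n z"
  shows "\<alpha> = \<beta>"
proof (rule PiE_ext)
  fix n assume "n \<in> pos_nats"
  then show "\<alpha> n = \<beta> n"
    using assms by (intro extensionalityI[of _ U]) (auto simp: arith_sections_carrier)
qed (use assms in \<open>auto simp: arith_sections_carrier\<close>)

lemma finsum_sections:
  assumes "open U" "z \<in> U" "finite I" "f \<in> I \<rightarrow> carrier (sections U)"
  shows "finsum (sections U) f I z = (\<Sum>i\<in>I. f i z)"
  using assms(3,4)
proof (induction I rule: finite_induct)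
  case empty
  interpret cring "sections U"
    using assms(1) by (rule sections_cring)
  show ?case
    using assms(2) by (simp add: finsum_empty) (simp add: fun_ring_def)
next
  case (insert i I)
  interpret cring "sections U"
    using assms(1) by (rule sections_cring)
  have "finsum (sections U) f (insert i I) = f i \<oplus>\<^bsub>sections U\<^esub> finsum (sections U) f I"
    using insert by (intro finsum_insert) auto
  then show ?case
    using insert assms(2) by (simp add: fun_ring_def)
qed

lemma arith_sections_eval:
  assumes "n > 0" "z \<in> U"
  shows "(\<alpha> \<oplus>\<^bsub>arith_sections U\<^esub> \<beta>) n z = \<alpha> n z + \<beta> n z"
    and "(c \<odot>\<^bsub>arith_sections U\<^esub> \<alpha>) n z = c * \<alpha> n z"
    and "\<one>\<^bsub>arith_sections U\<^esub> n z = (if n = 1 then 1 else 0)"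
  using assms
  by (simp_all add: arith_fun_algebra_const_def arith_fun_algebra_eval) (simp_all add: fun_ring_def)

lemma arith_sections_mult_eval:
  assumes "open U" "\<alpha> \<in> carrier (arith_sections U)" "\<beta> \<in> carrier (arith_sections U)"
    and "n > 0" "z \<in> U"
  shows "(\<alpha> \<otimes>\<^bsub>arith_sections U\<^esub> \<beta>) n z =
    (\<Sum>p\<in>factor_pairs n. \<alpha> (fst p) z * \<beta> (snd p) z)"
proof -
  interpret cring "sections U"
    using assms(1) by (rule sections_cring)
  have "(\<alpha> \<otimes>\<^bsub>arith_sections U\<^esub> \<beta>) n z =
      (\<Oplus>\<^bsub>sections U\<^esub>p\<in>factor_pairs n. \<alpha> (fst p) \<otimes>\<^bsub>sections U\<^esub> \<beta> (snd p)) z"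
    using \<open>n > 0\<close> by (simp add: arith_fun_algebra_const_def arith_fun_algebra_eval)
  also have "\<dots> = (\<Sum>p\<in>factor_pairs n. (\<alpha> (fst p) \<otimes>\<^bsub>sections U\<^esub> \<beta> (snd p)) z)"
    using assms
    by (intro finsum_sections finite_factor_pairs arith_fun_products_closed)
      (simp_all add: arith_fun_algebra_const_def)
  also have "\<dots> = (\<Sum>p\<in>factor_pairs n. \<alpha> (fst p) z * \<beta> (snd p) z)"
    using \<open>z \<in> U\<close> by (simp add: fun_ring_def)
  finally show ?thesis .
qed

end

section \<open>The derivation on arithmetical functions\<close>

text \<open>
  Two such classes for which differentiation maps the smaller into the larger. They are kept apart
  because the derivative of a differentiable real function need not be differentiable.
\<close>
locale differential_function_rings = P: function_rings P + Q: function_rings Q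
  for P Q :: "'a::real_normed_field set \<Rightarrow> ('a \<Rightarrow> 'a) set" +
  assumes subset: "open U \<Longrightarrow> P U \<subseteq> Q U"
    and differentiable: "\<lbrakk>open U; f \<in> P U; z \<in> U\<rbrakk> \<Longrightarrow> f field_differentiable at z"
    and deriv: "\<lbrakk>open U; f \<in> P U\<rbrakk> \<Longrightarrow> deriv f \<in> Q U"
begin

lemma has_deriv:
  "\<lbrakk>open U; f \<in> P U; z \<in> U\<rbrakk> \<Longrightarrow> (f has_field_derivative deriv f z) (at z)"
  using differentiable by (simp add: DERIV_deriv_iff_field_differentiable)

lemma D_tilde_eval:
  "\<lbrakk>n > 0; z \<in> U\<rbrakk> \<Longrightarrow> D_tilde U \<alpha> n z = deriv (\<alpha> n) z - \<alpha> n z * of_real (ln (real n))"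
  by (simp add: D_tilde_def)

lemma D_tilde_closed:
  assumes U: "open U" and \<alpha>: "\<alpha> \<in> carrier (P.arith_sections U)"
  shows "D_tilde U \<alpha> \<in> carrier (Q.arith_sections U)"
proof -
  have "(\<lambda>z\<in>U. deriv (\<alpha> n) z - \<alpha> n z * of_real (ln (real n))) \<in> Q U" if n: "n > 0" for n
  proof -
    have "\<alpha> n \<in> P U"
      using P.arith_sections_value[OF \<alpha> n] .
    then have "(\<lambda>z. deriv (\<alpha> n) z + \<alpha> n z * - of_real (ln (real n))) \<in> Q U"
      using subset[OF U] by (intro Q.add Q.mult Q.const deriv U) auto
    then show ?thesis
      by (rule Q.cong[OF U]) simp
  qed
  then show ?thesis
    by (auto simp: Q.arith_sections_carrier D_tilde_def)
qed

lemma deriv_convolution: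
  assumes U: "open U" and \<alpha>: "\<alpha> \<in> carrier (P.arith_sections U)"
    and \<beta>: "\<beta> \<in> carrier (P.arith_sections U)" and n: "n > 0" and z: "z \<in> U"
  shows "deriv ((\<alpha> \<otimes>\<^bsub>P.arith_sections U\<^esub> \<beta>) n) z = (\<Sum>p\<in>factor_pairs n.
    deriv (\<alpha> (fst p)) z * \<beta> (snd p) z + \<alpha> (fst p) z * deriv (\<beta> (snd p)) z)"
proof -
  have "deriv ((\<alpha> \<otimes>\<^bsub>P.arith_sections U\<^esub> \<beta>) n) z =
      deriv (\<lambda>w. \<Sum>p\<in>factor_pairs n. \<alpha> (fst p) w * \<beta> (snd p) w) z"
    using assms by (intro deriv_transform_within_open[OF U z] P.arith_sections_mult_eval)
  also have "\<dots> = (\<Sum>p\<in>factor_pairs n.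
    deriv (\<alpha> (fst p)) z * \<beta> (snd p) z + \<alpha> (fst p) z * deriv (\<beta> (snd p)) z)"
  proof (rule DERIV_imp_deriv, rule DERIV_sum)
    fix p assume "p \<in> factor_pairs n"
    then have "fst p > 0" "snd p > 0"
      using n by (auto intro!: Nat.gr0I)
    then have "(\<alpha> (fst p) has_field_derivative deriv (\<alpha> (fst p)) z) (at z)"
      "(\<beta> (snd p) has_field_derivative deriv (\<beta> (snd p)) z) (at z)"
      using P.arith_sections_value[OF \<alpha>] P.arith_sections_value[OF \<beta>] has_deriv[OF U _ z] by auto
    from DERIV_mult'[OF this]
    show "((\<lambda>w. \<alpha> (fst p) w * \<beta> (snd p) w) has_field_derivative
        deriv (\<alpha> (fst p)) z * \<beta> (snd p) z + \<alpha> (fst p) z * deriv (\<beta> (snd p)) z) (at z)"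
      by (simp add: add.commute)
  qed
  finally show ?thesis .
qed

lemma D_tilde_derivation_into:
  assumes U: "open U"
  shows "derivation_into ring_of_type_algebra (P.arith_sections U) (Q.arith_sections U) (D_tilde U)"
proof -
  let ?S = "P.arith_sections U" and ?T = "Q.arith_sections U"
  interpret S: algebra ring_of_type_algebra ?S
    using U by (rule P.arith_algebra_const)
  interpret T: algebra ring_of_type_algebra ?T
    using U by (rule Q.arith_algebra_const)
  have scalar: "c \<in> carrier ring_of_type_algebra" for c :: 'a
    by (simp add: ring_of_type_algebra_def)
  have sub: "\<alpha> \<in> carrier ?T" if "\<alpha> \<in> carrier ?S" for \<alpha>
    using that subset[OF U] by (auto simp: P.arith_sections_carrier Q.arith_sections_carrier)
  note vals = P.arith_sections_value[THEN has_deriv[OF U]]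
  note evals = P.arith_sections_eval Q.arith_sections_eval D_tilde_eval
  show ?thesis
  proof (intro derivation_into.intro derivation_into_axioms.intro S.algebra_axioms T.algebra_axioms)
    show "(\<lambda>\<alpha>. \<alpha>) \<in> ring_hom ?S ?T"
    proof (rule ring_hom_memI)
      fix \<alpha> \<beta> assume \<alpha>\<beta>: "\<alpha> \<in> carrier ?S" "\<beta> \<in> carrier ?S"
      \<comment> \<open>the two convolutions are sums in different rings, with the same values\<close>
      show "\<alpha> \<otimes>\<^bsub>?S\<^esub> \<beta> = \<alpha> \<otimes>\<^bsub>?T\<^esub> \<beta>"
        using \<alpha>\<beta> sub by (intro Q.arith_sections_eqI[of _ U])
          (simp_all add: P.arith_sections_mult_eval Q.arith_sections_mult_eval U)
      show "\<alpha> \<oplus>\<^bsub>?S\<^esub> \<beta> = \<alpha> \<oplus>\<^bsub>?T\<^esub> \<beta>"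
        using \<alpha>\<beta> sub by (intro Q.arith_sections_eqI[of _ U]) (simp_all add: evals)
      show "\<alpha> \<in> carrier ?T"
        using \<alpha>\<beta>(1) by (rule sub)
    next
      show "\<one>\<^bsub>?S\<^esub> = \<one>\<^bsub>?T\<^esub>"
        using sub by (intro Q.arith_sections_eqI[of _ U]) (simp_all add: evals)
    qed
  next
    fix a \<alpha> assume \<alpha>: "\<alpha> \<in> carrier ?S"
    show "a \<odot>\<^bsub>?S\<^esub> \<alpha> = a \<odot>\<^bsub>?T\<^esub> \<alpha>"
      using \<alpha> sub scalar by (intro Q.arith_sections_eqI[of _ U]) (simp_all add: evals)
    show "D_tilde U (a \<odot>\<^bsub>?S\<^esub> \<alpha>) = a \<odot>\<^bsub>?T\<^esub> D_tilde U \<alpha>"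
    proof (rule Q.arith_sections_eqI)
      fix n :: nat and z assume n: "n > 0" and z: "z \<in> U"
      have "deriv ((a \<odot>\<^bsub>?S\<^esub> \<alpha>) n) z = deriv (\<lambda>w. a * \<alpha> n w) z"
        using n by (intro deriv_transform_within_open[OF U z]) (simp add: evals)
      also have "\<dots> = a * deriv (\<alpha> n) z"
        by (intro DERIV_imp_deriv DERIV_cmult vals \<alpha> n z)
      finally show "D_tilde U (a \<odot>\<^bsub>?S\<^esub> \<alpha>) n z = (a \<odot>\<^bsub>?T\<^esub> D_tilde U \<alpha>) n z"
        using n z by (simp add: evals algebra_simps)
    qed (use \<alpha> scalar in \<open>auto intro!: D_tilde_closed U\<close>)
  next
    fix \<alpha> \<beta> assume \<alpha>: "\<alpha> \<in> carrier ?S" and \<beta>: "\<beta> \<in> carrier ?S"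
    show "D_tilde U (\<alpha> \<oplus>\<^bsub>?S\<^esub> \<beta>) = D_tilde U \<alpha> \<oplus>\<^bsub>?T\<^esub> D_tilde U \<beta>"
    proof (rule Q.arith_sections_eqI)
      fix n :: nat and z assume n: "n > 0" and z: "z \<in> U"
      have "deriv ((\<alpha> \<oplus>\<^bsub>?S\<^esub> \<beta>) n) z = deriv (\<lambda>w. \<alpha> n w + \<beta> n w) z"
        using n by (intro deriv_transform_within_open[OF U z]) (simp add: evals)
      also have "\<dots> = deriv (\<alpha> n) z + deriv (\<beta> n) z"
        by (intro DERIV_imp_deriv DERIV_add vals \<alpha> \<beta> n z)
      finally show "D_tilde U (\<alpha> \<oplus>\<^bsub>?S\<^esub> \<beta>) n z = (D_tilde U \<alpha> \<oplus>\<^bsub>?T\<^esub> D_tilde U \<beta>) n z"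
        using n z by (simp add: evals algebra_simps)
    qed (use \<alpha> \<beta> in \<open>auto intro!: D_tilde_closed U\<close>)
    show "D_tilde U (\<alpha> \<otimes>\<^bsub>?S\<^esub> \<beta>) =
        \<alpha> \<otimes>\<^bsub>?T\<^esub> D_tilde U \<beta> \<oplus>\<^bsub>?T\<^esub> \<beta> \<otimes>\<^bsub>?T\<^esub> D_tilde U \<alpha>"
    proof (rule Q.arith_sections_eqI)
      fix n :: nat and z assume n: "n > 0" and z: "z \<in> U"
      have ln: "ln (real n) = ln (real (fst p)) + ln (real (snd p))" if "p \<in> factor_pairs n" for p
      proof -
        have "n = fst p * snd p" using that by auto
        then show ?thesis using n by (simp add: ln_mult)
      qed
      \<comment> \<open>with the factors in this order, both sums run over the same pairs \<open>(a, b)\<close>\<close>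
      have comm: "\<beta> \<otimes>\<^bsub>?T\<^esub> D_tilde U \<alpha> = D_tilde U \<alpha> \<otimes>\<^bsub>?T\<^esub> \<beta>"
        by (intro T.m_comm sub D_tilde_closed U \<alpha> \<beta>)
      have "D_tilde U (\<alpha> \<otimes>\<^bsub>?S\<^esub> \<beta>) n z =
          (\<Sum>p\<in>factor_pairs n.
            deriv (\<alpha> (fst p)) z * \<beta> (snd p) z + \<alpha> (fst p) z * deriv (\<beta> (snd p)) z) -
          (\<Sum>p\<in>factor_pairs n. \<alpha> (fst p) z * \<beta> (snd p) z) * of_real (ln (real n))"
        using n z by (simp add: D_tilde_eval deriv_convolution U \<alpha> \<beta> P.arith_sections_mult_eval)
      also have "\<dots> = (\<Sum>p\<in>factor_pairs n.
            \<alpha> (fst p) z * D_tilde U \<beta> (snd p) z + D_tilde U \<alpha> (fst p) z * \<beta> (snd p) z)"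
        unfolding sum_distrib_right sum_subtractf[symmetric]
      proof (rule sum.cong[OF refl])
        fix p assume p: "p \<in> factor_pairs n"
        then have "fst p > 0" "snd p > 0"
          using n by (auto intro!: Nat.gr0I)
        then show "deriv (\<alpha> (fst p)) z * \<beta> (snd p) z + \<alpha> (fst p) z * deriv (\<beta> (snd p)) z -
              \<alpha> (fst p) z * \<beta> (snd p) z * of_real (ln (real n)) =
            \<alpha> (fst p) z * D_tilde U \<beta> (snd p) z + D_tilde U \<alpha> (fst p) z * \<beta> (snd p) z"
          using z by (simp add: D_tilde_eval ln[OF p] algebra_simps)
      qed
      also have "\<dots> = (\<alpha> \<otimes>\<^bsub>?T\<^esub> D_tilde U \<beta>) n z + (D_tilde U \<alpha> \<otimes>\<^bsub>?T\<^esub> \<beta>) n z"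
        using n z
        by (simp add: Q.arith_sections_mult_eval U sub \<alpha> \<beta> D_tilde_closed sum.distrib)
      finally show "D_tilde U (\<alpha> \<otimes>\<^bsub>?S\<^esub> \<beta>) n z =
          (\<alpha> \<otimes>\<^bsub>?T\<^esub> D_tilde U \<beta> \<oplus>\<^bsub>?T\<^esub> \<beta> \<otimes>\<^bsub>?T\<^esub> D_tilde U \<alpha>) n z"
        unfolding comm using n z by (simp add: evals)
    qed (use \<alpha> \<beta> sub in \<open>auto intro!: D_tilde_closed U\<close>)
  qed (rule D_tilde_closed[OF U])
qed

lemma D_tilde_sheaf_derivation_into:
  "sheaf_derivation_into ring_of_type_algebra P.arith_sections Q.arith_sections arith_res D_tilde"
proof (intro sheaf_derivation_into.intro sheaf_derivation_into_axioms.intro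
    P.arith_sheaf_const Q.arith_sheaf_const D_tilde_derivation_into)
  fix U V :: "'a set" and \<alpha> :: "nat \<Rightarrow> 'a \<Rightarrow> 'a"
  assume V: "open V" "V \<subseteq> U"
  \<comment> \<open>derivatives are local: truncation to the open set \<open>V\<close> does not change them on \<open>V\<close>\<close>
  have "deriv (restrict (\<alpha> n) V) z = deriv (\<alpha> n) z" if "z \<in> V" for n z
    by (rule deriv_transform_within_open[OF V(1) that]) simp
  then show "arith_res U V (D_tilde U \<alpha>) = D_tilde V (arith_res U V \<alpha>)"
    using V(2) by (auto simp: arith_res_def fun_res_def D_tilde_def fun_eq_iff)
qed

end

section \<open>Differentiable, smooth and holomorphic functions\<close>

lemma all_functions: "function_rings (\<lambda>U. UNIV)"
  by unfold_locales auto

lemma differentiable_functions: "function_rings (\<lambda>U::real set. {f. f differentiable_on U})"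
proof
  fix U :: "real set" and f g :: "real \<Rightarrow> real"
  assume U: "open U" and f: "f \<in> {f. f differentiable_on U}" and eq: "\<And>z. z \<in> U \<Longrightarrow> g z = f z"
  have "g differentiable at z" if "z \<in> U" for z
  proof -
    have "f differentiable at z"
      using f U that by (simp add: differentiable_on_eq_differentiable_at)
    then obtain D where "(f has_derivative D) (at z)"
      by (auto simp: differentiable_def)
    then have "(g has_derivative D) (at z)"
      by (rule has_derivative_transform_within_open[OF _ U that]) (simp add: eq)
    then show ?thesis
      by (auto simp: differentiable_def)
  qed
  then show "g \<in> {f. f differentiable_on U}"
    using U by (simp add: differentiable_on_eq_differentiable_at)
next
  show "f \<in> {f. f differentiable_on \<Union>\<U>}"
    if "\<And>V. V \<in> \<U> \<Longrightarrow> open V" "\<And>V. V \<in> \<U> \<Longrightarrow> f \<in> {f. f differentiable_on V}"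
    for \<U> :: "real set set" and f :: "real \<Rightarrow> real"
    using that by (auto simp: differentiable_on_eq_differentiable_at open_Union)
qed (auto simp: differentiable_on_eq_differentiable_at)

lemma deriv_real_differentiable:
  "\<lbrakk>open U; f differentiable_on U; z \<in> U\<rbrakk> \<Longrightarrow> (f has_field_derivative deriv f z) (at z)"
  for f :: "real \<Rightarrow> real"
  by (simp add: differentiable_on_eq_differentiable_at DERIV_deriv_iff_real_differentiable)

text \<open>
  The real functions that are \<open>k + 1\<close> times differentiable on \<open>U\<close>: every iterated derivative of
  order at most \<open>k\<close> is differentiable. Thus \<open>k = 0\<close> is the class of differentiable functions.
  Smoothness is treated as the intersection of these classes, because closure under products is an
  induction on \<open>k\<close>: the derivative \<open>f g' + f' g\<close> of a product involves \<open>f\<close> and \<open>g\<close> themselves, which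
  must belong to the previous class.
\<close>
definition times_differentiable :: "nat \<Rightarrow> real set \<Rightarrow> (real \<Rightarrow> real) set" where
  "times_differentiable k U = {f. \<forall>j\<le>k. (deriv ^^ j) f differentiable_on U}"

lemma times_differentiable_0: "times_differentiable 0 U = {f. f differentiable_on U}"
  by (simp add: times_differentiable_def)

lemma times_differentiable_Suc:
  "times_differentiable (Suc k) U =
    {f. f differentiable_on U \<and> deriv f \<in> times_differentiable k U}"
  by (auto simp: times_differentiable_def less_Suc_eq_le[symmetric] All_less_Suc2 funpow_Suc_right
      simp del: funpow.simps(2))

lemma times_differentiable_functions: "function_rings (times_differentiable k)"
proof (induction k)
  case 0
  show ?case
    unfolding times_differentiable_0[abs_def] by (rule differentiable_functions)
next
  case (Suc k)
  interpret function_rings "times_differentiable k" by (rule Suc)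
  interpret D1: function_rings "\<lambda>U::real set. {f. f differentiable_on U}"
    by (rule differentiable_functions)
  have mem: "f \<in> times_differentiable (Suc k) U \<longleftrightarrow>
      f \<in> {f. f differentiable_on U} \<and> deriv f \<in> times_differentiable k U" for f U
    by (simp add: times_differentiable_Suc)
  have lower: "f \<in> times_differentiable k U" if "f \<in> times_differentiable (Suc k) U" for f U
    using that by (auto simp: times_differentiable_def)
  show ?case
  proof
    fix U :: "real set" and f g :: "real \<Rightarrow> real"
    assume U: "open U" and f: "f \<in> times_differentiable (Suc k) U"
    show "g \<in> times_differentiable (Suc k) U" if eq: "\<And>z. z \<in> U \<Longrightarrow> g z = f z"
    proof -
      have "deriv g z = deriv f z" if "z \<in> U" for z
        using U that eq by (rule deriv_transform_within_open)
      then show ?thesis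
        using f D1.cong[OF U, of f g] cong[OF U, of "deriv f" "deriv g"] eq by (simp add: mem)
    qed
    show "f \<in> times_differentiable (Suc k) V" if "open V" "V \<subseteq> U" for V
      using f D1.mono[OF U that, of f] mono[OF U that, of "deriv f"] by (simp add: mem)
    assume g: "g \<in> times_differentiable (Suc k) U"
    have df: "(f has_field_derivative deriv f z) (at z)"
      and dg: "(g has_field_derivative deriv g z) (at z)" if "z \<in> U" for z
      using f g that U by (auto simp: mem intro: deriv_real_differentiable)
    have "deriv (\<lambda>z. f z + g z) z = deriv f z + deriv g z" if "z \<in> U" for z
      by (intro DERIV_imp_deriv DERIV_add df dg that)
    moreover have "(\<lambda>z. deriv f z + deriv g z) \<in> times_differentiable k U"
      using f g by (intro add U) (auto simp: mem)
    ultimately have "deriv (\<lambda>z. f z + g z) \<in> times_differentiable k U"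
      using U by (blast intro: cong)
    then show "(\<lambda>z. f z + g z) \<in> times_differentiable (Suc k) U"
      using f g D1.add[OF U, of f g] by (simp add: mem)
    have "deriv (\<lambda>z. f z * g z) z = f z * deriv g z + deriv f z * g z" if "z \<in> U" for z
      by (intro DERIV_imp_deriv DERIV_mult' df dg that)
    moreover have "(\<lambda>z. f z * deriv g z + deriv f z * g z) \<in> times_differentiable k U"
      using f g lower[OF f] lower[OF g] by (intro add mult U) (auto simp: mem)
    ultimately have "deriv (\<lambda>z. f z * g z) \<in> times_differentiable k U"
      using U by (blast intro: cong)
    then show "(\<lambda>z. f z * g z) \<in> times_differentiable (Suc k) U"
      using f g D1.mult[OF U, of f g] by (simp add: mem)
  next
    fix \<U> :: "real set set" and f :: "real \<Rightarrow> real"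
    assume op: "\<And>V. V \<in> \<U> \<Longrightarrow> open V"
      and "\<And>V. V \<in> \<U> \<Longrightarrow> f \<in> times_differentiable (Suc k) V"
    then show "f \<in> times_differentiable (Suc k) (\<Union>\<U>)"
      using D1.union[OF op, of \<U> f] union[OF op, of \<U> "deriv f"] by (simp add: mem)
  next
    fix U :: "real set" and c :: real
    assume "open U"
    then show "(\<lambda>z. c) \<in> times_differentiable (Suc k) U"
      using D1.const[of U c] const[of U 0] by (simp add: mem)
  qed
qed

lemma smooth_eq_times_differentiable:
  "{f. \<forall>k. (deriv ^^ k) f differentiable_on U} = (\<Inter>k. times_differentiable k U)"
  by (auto simp: times_differentiable_def)

lemma function_rings_Inter:
  assumes "\<And>k. function_rings (P k)"
  shows "function_rings (\<lambda>U. \<Inter>k. P k U)"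
proof -
  interpret function_rings "P k" for k by (rule assms)
  show ?thesis
    by unfold_locales (auto intro: cong mono union const add mult)
qed

lemma smooth_functions:
  "function_rings (\<lambda>U::real set. {f. \<forall>k. (deriv ^^ k) f differentiable_on U})"
  unfolding smooth_eq_times_differentiable
  by (intro function_rings_Inter times_differentiable_functions)

lemma holomorphic_functions: "function_rings (\<lambda>U::complex set. {f. f holomorphic_on U})"
proof
  show "f \<in> {f. f holomorphic_on \<Union>\<U>}"
    if "\<And>V. V \<in> \<U> \<Longrightarrow> open V" "\<And>V. V \<in> \<U> \<Longrightarrow> f \<in> {f. f holomorphic_on V}"
    for \<U> :: "complex set set" and f :: "complex \<Rightarrow> complex"
    using that holomorphic_on_UN_open[of \<U> f "\<lambda>V. V"] by simp
qed (auto intro: holomorphic_transform holomorphic_on_subset intro!: holomorphic_intros)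

lemma differentiable_derivation:
  "differential_function_rings (\<lambda>U::real set. {f. f differentiable_on U}) (\<lambda>U. UNIV)"
proof (intro differential_function_rings.intro differential_function_rings_axioms.intro
    differentiable_functions all_functions)
  fix U :: "real set" and f :: "real \<Rightarrow> real" and z
  assume "open U" "f \<in> {f. f differentiable_on U}" "z \<in> U"
  then show "f field_differentiable at z"
    using deriv_real_differentiable[of U f z] by (auto simp: field_differentiable_def)
qed auto

lemma smooth_derivation:
  "differential_function_rings (\<lambda>U::real set. {f. \<forall>k. (deriv ^^ k) f differentiable_on U})
    (\<lambda>U. {f. \<forall>k. (deriv ^^ k) f differentiable_on U})"
proof (intro differential_function_rings.intro differential_function_rings_axioms.intro
    smooth_functions)
  fix U :: "real set" and f :: "real \<Rightarrow> real"
  assume "open U" and f: "f \<in> {f. \<forall>k. (deriv ^^ k) f differentiable_on U}"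
  then have *: "(deriv ^^ k) f differentiable_on U" for k
    by simp
  show "f field_differentiable at z" if "z \<in> U" for z
    using deriv_real_differentiable[of U f z] *[of 0] that \<open>open U\<close>
    by (auto simp: field_differentiable_def)
  have "(deriv ^^ k) (deriv f) differentiable_on U" for k
    using *[of "Suc k"] by (simp add: funpow_Suc_right del: funpow.simps)
  then show "deriv f \<in> {f. \<forall>k. (deriv ^^ k) f differentiable_on U}"
    by simp
qed simp

lemma holomorphic_derivation:
  "differential_function_rings (\<lambda>U::complex set. {f. f holomorphic_on U})
    (\<lambda>U. {f. f holomorphic_on U})"
  by (intro differential_function_rings.intro differential_function_rings_axioms.intro
      holomorphic_functions)
    (auto intro: holomorphic_deriv holomorphic_on_imp_differentiable_at)

theorem proposition2p9:
  shows
    "(\<comment> \<open>real case, differentiable functions\<close>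
      (\<forall>U::real set. open U \<longrightarrow>
        derivation_into ring_of_type_algebra
          (arith_fun_algebra_const differentiable_ring U) (arith_fun_algebra_const all_ring U)
          (D_tilde U)) \<and>
      sheaf_of_algebras differentiable_ring fun_res
        (\<lambda>U. arith_fun_algebra (differentiable_ring U)) arith_res \<and>
      sheaf_derivation_into ring_of_type_algebra
        (arith_fun_algebra_const differentiable_ring) (arith_fun_algebra_const all_ring)
        arith_res D_tilde) \<and>
     (\<comment> \<open>real case, infinitely differentiable functions\<close>
      (\<forall>U::real set. open U \<longrightarrow>
        derivation ring_of_type_algebra (arith_fun_algebra_const smooth_ring U) (D_tilde U)) \<and>
      sheaf_of_algebras smooth_ring fun_res
        (\<lambda>U. arith_fun_algebra (smooth_ring U)) arith_res \<and>
      sheaf_derivation ring_of_type_algebra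
        (arith_fun_algebra_const smooth_ring) arith_res D_tilde) \<and>
     (\<comment> \<open>complex case, holomorphic functions\<close>
      (\<forall>U::complex set. open U \<longrightarrow>
        derivation ring_of_type_algebra (arith_fun_algebra_const holomorphic_ring U) (D_tilde U)) \<and>
      sheaf_of_algebras holomorphic_ring fun_res
        (\<lambda>U. arith_fun_algebra (holomorphic_ring U)) arith_res \<and>
      sheaf_derivation ring_of_type_algebra
        (arith_fun_algebra_const holomorphic_ring) arith_res D_tilde)"
proof (intro conjI allI impI)
  note defs = differentiable_ring_def[abs_def] smooth_ring_def[abs_def]
    holomorphic_ring_def[abs_def] all_ring_def[abs_def]
  interpret dif: differential_function_rings "\<lambda>U::real set. {f. f differentiable_on U}" "\<lambda>U. UNIV"
    by (rule differentiable_derivation)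
  interpret smo: differential_function_rings
    "\<lambda>U::real set. {f. \<forall>k. (deriv ^^ k) f differentiable_on U}"
    "\<lambda>U. {f. \<forall>k. (deriv ^^ k) f differentiable_on U}"
    by (rule smooth_derivation)
  interpret hol: differential_function_rings "\<lambda>U::complex set. {f. f holomorphic_on U}"
    "\<lambda>U. {f. f holomorphic_on U}"
    by (rule holomorphic_derivation)
  show "derivation_into ring_of_type_algebra (arith_fun_algebra_const differentiable_ring U)
      (arith_fun_algebra_const all_ring U) (D_tilde U)" if "open U" for U
    unfolding defs using that by (rule dif.D_tilde_derivation_into)
  show "sheaf_of_algebras differentiable_ring fun_res
      (\<lambda>U. arith_fun_algebra (differentiable_ring U)) arith_res"
    unfolding defs by (rule dif.P.arith_sheaf)
  show "sheaf_derivation_into ring_of_type_algebra (arith_fun_algebra_const differentiable_ring)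
      (arith_fun_algebra_const all_ring) arith_res D_tilde"
    unfolding defs by (rule dif.D_tilde_sheaf_derivation_into)
  show "derivation ring_of_type_algebra (arith_fun_algebra_const smooth_ring U) (D_tilde U)"
    if "open U" for U
    unfolding defs using that by (intro derivation_into_self smo.D_tilde_derivation_into)
  show "sheaf_of_algebras smooth_ring fun_res
      (\<lambda>U. arith_fun_algebra (smooth_ring U)) arith_res"
    unfolding defs by (rule smo.P.arith_sheaf)
  show "sheaf_derivation ring_of_type_algebra (arith_fun_algebra_const smooth_ring)
      arith_res D_tilde"
    unfolding defs by (intro sheaf_derivation_into_self smo.D_tilde_sheaf_derivation_into)
  show "derivation ring_of_type_algebra (arith_fun_algebra_const holomorphic_ring U) (D_tilde U)"
    if "open U" for U
    unfolding defs using that by (intro derivation_into_self hol.D_tilde_derivation_into)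
  show "sheaf_of_algebras holomorphic_ring fun_res
      (\<lambda>U. arith_fun_algebra (holomorphic_ring U)) arith_res"
    unfolding defs by (rule hol.P.arith_sheaf)
  show "sheaf_derivation ring_of_type_algebra (arith_fun_algebra_const holomorphic_ring)
      arith_res D_tilde"
    unfolding defs by (intro sheaf_derivation_into_self hol.D_tilde_sheaf_derivation_into)
qed

end
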